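(* Let $\mathcal H$ be a real Hilbert space, and let $T\colon\mathcal H\to\mathcal H$ and $U\colon\mathcal H\to\mathcal H$ be $\lambda$- and $\mu$-relaxed cutters, respectively, where $\lambda,\mu>0$. Assume that $\lambda\mu<4$ and $\operatorname{Fix}T\cap\operatorname{Fix}U\neq\emptyset$. Put $\nu:=\frac{4(\lambda+\mu-\lambda\mu)}{4-\lambda\mu}$ and consider the iterative method $$x^0\in\mathcal H,\qquad x^{k+1}:=x^k+\frac{\alpha_k}{\nu}\big(U(T(x^k))-x^k\big),\qquad k=0,1,2,\ldots,$$ where $\alpha_k\in[\varepsilon,2-\varepsilon]$ for all $k$ and $\varepsilon>0$. Let $z\in\operatorname{Fix}T\cap\operatorname{Fix}U$, let $r:=\|x^0-z\|>0$ and put $R:=\max\{r,(\lambda-1)r\}$. The following statements hold: (i) If $T$ is weakly regular over $B(z,r)$ and $U$ is weakly regular over $B(z,R)$, then $\{x^k\}_{k=0}^\infty$ converges weakly to some $x^*\in\operatorname{Fix}T\cap\operatorname{Fix}U$. (ii) If $T$ is regular over $B(z,r)$, $U$ is regular over $B(z,R)$ and the pair $\{\operatorname{Fix}T,\operatorname{Fix}U\}$ is regular over $B(z,r)$, then $\{x^k\}_{k=0}^\infty$ converges in norm to some $x^*\in\operatorname{Fix}T\cap\operatorname{Fix}U$. (iii) If $T$ is $\delta_1$-linearly regular over $B(z,r)$, $U$ is $\delta_2$-linearly regular over $B(z,R)$ and the pair $\{\operatorname{Fix}T,\operatorname{Fix}U\}$ is $\kappa$-linearly regular over $B(z,r)$,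 where $\delta_1,\delta_2\in(0,1]$ and $\kappa>0$, then $\{x^k\}_{k=0}^\infty$ converges $Q$-linearly to some $x^*\in\operatorname{Fix}T\cap\operatorname{Fix}U$ at the rate $\sqrt{1-\left(\frac{\varepsilon\delta}{2\nu}\right)^2}$, that is, $$\|x^{k+1}-x^*\|\le\sqrt{1-\left(\frac{\varepsilon\delta}{2\nu}\right)^2}\;\|x^k-x^*\|,\qquad k=0,1,2,\ldots,$$ where $$\delta:=\left(\frac{|\alpha|\min\{\delta_1,\delta_2\}}{2\kappa(1+\beta\sqrt{\nu})}\right)^2,\quad \alpha:=\sqrt{\tfrac1\lambda-\tfrac1\nu}-\sqrt{\tfrac1\mu-\tfrac1\nu}\neq0,\quad \beta:=\max\left\{\sqrt{\tfrac1\lambda-\tfrac1\nu},\ \sqrt{\tfrac1\mu-\tfrac1\nu}\right\}>0.$$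
   Context: $\operatorname{Fix}T:=\{x\in\mathcal H: T(x)=x\}$; $B(z,r)$ is the closed ball with center $z$ and radius $r$; $d(x,A):=\inf_{a\in A}\|x-a\|$; $\rightharpoonup$ denotes weak convergence. An operator $S\colon\mathcal H\to\mathcal H$ with $\operatorname{Fix}S\neq\emptyset$ is a cutter if $\langle z-S(x),x-S(x)\rangle\le 0$ for all $x\in\mathcal H$ and all $z\in\operatorname{Fix}S$. For $\lambda>0$, a $\lambda$-relaxed cutter is an operator of the form $\operatorname{Id}+\lambda(S-\operatorname{Id})$ with $S$ a cutter (it has the same fixed point set as $S$; this set is closed and convex). For $\lambda,\mu>0$ with $\lambda\mu<4$ one has $\nu\ge\max\{\lambda,\mu\}>0$, so the square roots in $\alpha,\beta$ are well defined. Regularity of operators. Let $S\subseteq\mathcal H$ be nonempty. An operator $T\colon\mathcal H\to\mathcal H$ is: - weakly regular over $S$ if for every sequence $\{x^k\}\subseteq S$: $x^k\rightharpoonup y$ and $\|T(x^k)-x^k\|\to0$ imply $y\in\operatorname{Fix}T$; - regular over $S$ if for every sequence $\{x^k\}\subseteq S$: $\|T(x^k)-x^k\|\to0$ implies $d(x^k,\operatorname{Fix}T)\to0$; - $\delta$-linearly regular over $S$, where $\delta>0$, if $\|T(x)-x\|\ge\delta\, d(x,\operatorname{Fix}T)$ for all $x\in S$. Regularity of sets. Let $A,B\subseteq\mathcal H$ be closed and convex with $A\cap B\ne\emptyset$ and $S\subseteq\mathcal H$ nonempty. The pair $\{A,B\}$ is: - regular over $S$ if for every sequence $\{x^k\}\subseteq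 S$: $\max\{d(x^k,A),d(x^k,B)\}\to0$ implies $d(x^k,A\cap B)\to0$; - $\kappa$-linearly regular over $S$, where $\kappa>0$, if $d(x,A\cap B)\le\kappa\max\{d(x,A),d(x,B)\}$ for all $x\in S$.
   Formalization: The claim α ≠ 0 is proved only for λ ≠ μ, since for λ = μ (e.g. λ = μ = 1) both square roots coincide and α = 0; in that case (iii) is still proved, but with δ = 0 and rate 1. *)

theory Defs
  imports "HOL-Analysis.Analysis"
begin

definition Fix :: "('a \<Rightarrow> 'a) \<Rightarrow> 'a set" where
  "Fix T = {x. T x = x}"

definition cutter :: "('a::real_inner \<Rightarrow> 'a) \<Rightarrow> bool" where
  "cutter S \<longleftrightarrow> Fix S \<noteq> {} \<and> (\<forall>x. \<forall>z\<in>Fix S. (z - S x) \<bullet> (x - S x) \<le> 0)"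

definition relaxed_cutter :: "real \<Rightarrow> ('a::real_inner \<Rightarrow> 'a) \<Rightarrow> bool" where
  "relaxed_cutter c T \<longleftrightarrow> (\<exists>S. cutter S \<and> T = (\<lambda>x. x + c *\<^sub>R (S x - x)))"

definition weakly_converges :: "(nat \<Rightarrow> 'a::real_inner) \<Rightarrow> 'a \<Rightarrow> bool" where
  "weakly_converges x y \<longleftrightarrow> (\<forall>v. (\<lambda>k. x k \<bullet> v) \<longlonglongrightarrow> y \<bullet> v)"

definition weakly_regular_over :: "('a::real_inner \<Rightarrow> 'a) \<Rightarrow> 'a set \<Rightarrow> bool" where
  "weakly_regular_over T S \<longleftrightarrow>
     (\<forall>x y. (\<forall>k. x k \<in> S) \<longrightarrow> weakly_converges x y \<longrightarrow> (\<lambda>k. norm (T (x k) - x k)) \<longlonglongrightarrow> 0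
        \<longrightarrow> y \<in> Fix T)"

text \<open>The distance \<open>infdist x A\<close> is the infimum of \<open>dist x a\<close> over \<open>a \<in> A\<close> when
  \<open>A\<close> is nonempty, but \<open>0\<close> by convention when \<open>A\<close> is empty. The notions below are meant
  for operators with a fixed point and for pairs of sets with a common point.\<close>

definition regular_over :: "('a::real_inner \<Rightarrow> 'a) \<Rightarrow> 'a set \<Rightarrow> bool" where
  "regular_over T S \<longleftrightarrow>
     (\<forall>x. (\<forall>k. x k \<in> S) \<longrightarrow> (\<lambda>k. norm (T (x k) - x k)) \<longlonglongrightarrow> 0
        \<longrightarrow> (\<lambda>k. infdist (x k) (Fix T)) \<longlonglongrightarrow> 0)"

definition linearly_regular_over :: "real \<Rightarrow> ('a::real_inner \<Rightarrow> 'a) \<Rightarrow> 'a set \<Rightarrow> bool" where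
  "linearly_regular_over \<delta> T S \<longleftrightarrow> (\<forall>x\<in>S. norm (T x - x) \<ge> \<delta> * infdist x (Fix T))"

text \<open>Regularity of a pair of sets is considered for closed convex \<open>A\<close> and \<open>B\<close>; the
  fixed point sets of relaxed cutters (with nonzero relaxation parameter) are always closed
  and convex, so this requirement is not part of the definitions.\<close>

definition pair_regular_over :: "'a::real_inner set \<Rightarrow> 'a set \<Rightarrow> 'a set \<Rightarrow> bool" where
  "pair_regular_over A B S \<longleftrightarrow>
     (\<forall>x. (\<forall>k. x k \<in> S) \<longrightarrow> (\<lambda>k. max (infdist (x k) A) (infdist (x k) B)) \<longlonglongrightarrow> 0
        \<longrightarrow> (\<lambda>k. infdist (x k) (A \<inter> B)) \<longlonglongrightarrow> 0)"

definition pair_linearly_regular_over ::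
  "real \<Rightarrow> 'a::real_inner set \<Rightarrow> 'a set \<Rightarrow> 'a set \<Rightarrow> bool" where
  "pair_linearly_regular_over \<kappa> A B S \<longleftrightarrow>
     (\<forall>x\<in>S. infdist x (A \<inter> B) \<le> \<kappa> * max (infdist x A) (infdist x B))"

end

theory Submission
  imports Defs "HOL-Complex_Analysis.Great_Picard"
begin

text \<open>With \<open>a = T x - x\<close>, \<open>b = U (T x) - T x\<close>, \<open>p\<^sup>2 = 1/l - 1/\<nu>\<close> and \<open>q\<^sup>2 = 1/m - 1/\<nu>\<close>, adding the
  two cutter inequalities and completing the square gives, for every common fixed point \<open>z\<close>,
  \<open>(z - x) \<bullet> (a + b) \<ge> (norm (a + b))\<^sup>2 / \<nu> + (norm (p a - s q b))\<^sup>2\<close> with a sign \<open>s\<close> for which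
  \<open>p + s q \<noteq> 0\<close>. The first term makes the iterates Fejer monotone; together the two terms force
  both displacements \<open>a\<close> and \<open>b\<close> to zero along the iteration, and under linear regularity they
  bound \<open>norm (a + b)\<close> from below by a multiple of the distance to the common fixed points.
  Weak convergence then follows from Opial's argument, and the rate with respect to the limit
  from the fact that a Fejer monotone sequence is at most twice as far from its limit as from
  the target set.\<close>

section \<open>Weak sequential compactness\<close>

text \<open>Riesz representation: the representing vector minimises \<open>(norm v)\<^sup>2 - 2 * \<phi> v\<close>, and
  the parallelogram law makes minimising sequences Cauchy.\<close>

lemma closed_subspace_Riesz:
  fixes V :: "'a::{real_inner, complete_space} set" and \<phi> :: "'a \<Rightarrow> real"
  assumes V: "subspace V" "closed V"
    and add: "\<And>u v. u \<in> V \<Longrightarrow> v \<in> V \<Longrightarrow> \<phi> (u + v) = \<phi> u + \<phi> v"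
    and scale: "\<And>c v. v \<in> V \<Longrightarrow> \<phi> (c *\<^sub>R v) = c * \<phi> v"
    and bound: "\<And>v. v \<in> V \<Longrightarrow> \<bar>\<phi> v\<bar> \<le> M * norm v"
  obtains y where "y \<in> V" "\<And>v. v \<in> V \<Longrightarrow> \<phi> v = y \<bullet> v"
proof -
  define J where "J v = (norm v)\<^sup>2 - 2 * \<phi> v" for v
  define i where "i = (INF v\<in>V. J v)"
  have "- M\<^sup>2 \<le> J v" if "v \<in> V" for v
  proof -
    have "0 \<le> (norm v - M)\<^sup>2" by simp
    then show ?thesis
      using bound[OF that] by (simp add: J_def power2_diff algebra_simps)
  qed
  then have bdd: "bdd_below (J ` V)"
    by (auto intro!: bdd_belowI)
  have i_le: "i \<le> J v" if "v \<in> V" for v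
    unfolding i_def using bdd that by (rule cINF_lower)
  have V0: "0 \<in> V" using V(1) by (rule subspace_0)
  have "\<exists>v\<in>V. J v < i + 1 / real (Suc n)" for n
    using cINF_less_iff[of V J "i + 1 / real (Suc n)"] bdd V0 by (auto simp: i_def)
  then obtain u where u: "\<And>n. u n \<in> V" "\<And>n. J (u n) < i + 1 / real (Suc n)"
    by metis
  have minus: "\<phi> (v - w) = \<phi> v - \<phi> w" if "v \<in> V" "w \<in> V" for v w
    using add[of v "(-1) *\<^sub>R w"] scale[of w "-1"] that V(1)
    by (simp add: subspace_neg)
  have par: "(norm (v - w))\<^sup>2 \<le> 2 * (J v - i) + 2 * (J w - i)" if "v \<in> V" "w \<in> V" for v w
  proof -
    have "i \<le> J ((1/2) *\<^sub>R (v + w))"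
      using that V(1) by (intro i_le subspace_scale subspace_add)
    also have "\<dots> = (norm (v + w))\<^sup>2 / 4 - (\<phi> v + \<phi> w)"
      using that V(1) scale[of "v + w" "1/2"] add[of v w]
      by (simp add: J_def subspace_add power_divide)
    finally have "4 * i \<le> (norm (v + w))\<^sup>2 - 4 * (\<phi> v + \<phi> w)" by simp
    moreover have "(norm (v - w))\<^sup>2 + (norm (v + w))\<^sup>2 = 2 * (norm v)\<^sup>2 + 2 * (norm w)\<^sup>2"
      by (simp add: power2_norm_eq_inner inner_diff inner_add inner_commute)
    ultimately show ?thesis by (simp add: J_def)
  qed
  have "Cauchy u"
  proof (rule metric_CauchyI)
    fix e :: real assume "e > 0"
    then obtain N where N: "inverse (real (Suc N)) < e\<^sup>2 / 4"
      using reals_Archimedean[of "e\<^sup>2 / 4"] by auto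
    show "\<exists>N. \<forall>m\<ge>N. \<forall>n\<ge>N. dist (u m) (u n) < e"
    proof (intro exI allI impI)
      fix m n assume "N \<le> m" "N \<le> n"
      then have "1 / real (Suc m) \<le> inverse (real (Suc N))" "1 / real (Suc n) \<le> inverse (real (Suc N))"
        by (auto simp: field_simps)
      then have "J (u m) - i < e\<^sup>2 / 4" "J (u n) - i < e\<^sup>2 / 4"
        using u(2)[of m] u(2)[of n] N by (simp_all del: of_nat_Suc)
      then have "(norm (u m - u n))\<^sup>2 < e\<^sup>2"
        using par[OF u(1)[of m] u(1)[of n]] by simp
      then show "dist (u m) (u n) < e"
        using \<open>e > 0\<close> by (simp add: dist_norm power_less_imp_less_base)
    qed
  qed
  then obtain y where y: "u \<longlonglongrightarrow> y"
    using Cauchy_convergent convergent_def by blast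
  have yV: "y \<in> V" using V(2) u(1) y by (rule closed_sequentially)
  have "(\<lambda>n. \<phi> (u n)) \<longlonglongrightarrow> \<phi> y"
  proof (rule Lim_null_comparison[THEN LIM_zero_cancel])
    show "\<forall>\<^sub>F n in sequentially. norm (\<phi> (u n) - \<phi> y) \<le> M * norm (u n - y)"
      using minus[OF u(1) yV] bound[OF subspace_diff[OF V(1) u(1) yV]] by simp
    show "(\<lambda>n. M * norm (u n - y)) \<longlonglongrightarrow> 0"
      using tendsto_mult_right_zero[OF tendsto_norm_zero[OF LIM_zero[OF y]]] .
  qed
  then have "(\<lambda>n. J (u n)) \<longlonglongrightarrow> J y"
    unfolding J_def by (intro tendsto_intros y)
  moreover have "(\<lambda>n. i + 1 / real (Suc n)) \<longlonglongrightarrow> i + 0"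
    by (intro tendsto_intros LIMSEQ_Suc[OF lim_1_over_n])
  ultimately have Jy: "J y \<le> i"
    using u(2) by (auto intro: LIMSEQ_le less_imp_le)
  have "\<phi> v = y \<bullet> v" if v: "v \<in> V" for v
  proof (cases "v = 0")
    case True
    then show ?thesis using scale[OF v, of 0] by simp
  next
    case False
    \<comment> \<open>\<open>2 * g\<close> is the derivative of \<open>J\<close> at \<open>y\<close>
      in direction \<open>v\<close>, and \<open>t\<close> minimises the resulting quadratic along
      that direction. The drop \<open>g\<^sup>2 / (norm v)\<^sup>2\<close> is incompatible with
      minimality of \<open>y\<close> unless \<open>g = 0\<close>.\<close>
    define g where "g = y \<bullet> v - \<phi> v"
    define t where "t = - g / (norm v)\<^sup>2"
    have "J y \<le> J (y + t *\<^sub>R v)"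
      using Jy i_le[of "y + t *\<^sub>R v"] V(1) yV v by (simp add: subspace_add subspace_scale)
    also have "\<dots> = J y + 2 * t * g + t\<^sup>2 * (norm v)\<^sup>2"
    proof -
      have "(norm (y + t *\<^sub>R v))\<^sup>2 = (norm y)\<^sup>2 + 2 * t * (y \<bullet> v) + t\<^sup>2 * (norm v)\<^sup>2"
        unfolding power2_norm_eq_inner
        by (simp add: inner_add inner_commute power2_eq_square)
      then show ?thesis
        using add[OF yV subspace_scale[OF V(1) v, of t]] scale[OF v, of t]
        by (simp add: J_def g_def algebra_simps)
    qed
    also have "\<dots> = J y - g\<^sup>2 / (norm v)\<^sup>2"
      using False by (simp add: t_def field_simps power2_eq_square)
    finally have "g = 0" using False by (simp add: divide_le_0_iff)
    then show ?thesis by (simp add: g_def)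
  qed
  with yV show ?thesis using that by blast
qed

text \<open>Diagonal extraction makes the inner products with every \<open>x i\<close> converge. The
  directions of convergence form a closed subspace \<open>V\<close>, the limits form a bounded
  linear functional on \<open>V\<close>, and its Riesz representative is the weak limit.\<close>

lemma bounded_imp_weakly_convergent_subsequence:
  fixes x :: "nat \<Rightarrow> 'a::{real_inner, complete_space}"
  assumes M: "\<And>n. norm (x n) \<le> M"
  obtains s y where "strict_mono s" "weakly_converges (x \<circ> s) y"
proof -
  have "\<bar>x n \<bullet> x i\<bar> \<le> M * M" for n i
    by (meson Cauchy_Schwarz_ineq2 M mult_mono norm_ge_zero order_trans)
  then have bound: "norm (x n \<bullet> x i) \<le> M * M" for n i
    by simp
  obtain s :: "nat \<Rightarrow> nat" where s: "strict_mono s"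
    and conv: "\<And>i. \<exists>l. (\<lambda>n. x (s n) \<bullet> x i) \<longlonglongrightarrow> l"
    by (rule function_convergent_subsequence
        [where f = "\<lambda>n i. x n \<bullet> x i", OF countableI_type[of "UNIV :: nat set"] bound]) blast
  define V where "V = {v. convergent (\<lambda>n. x (s n) \<bullet> v)}"
  have xV: "x i \<in> V" for i
    using conv by (auto simp: V_def convergent_def)
  have V: "subspace V"
  proof (rule subspaceI)
    show "0 \<in> V"
      by (simp add: V_def convergent_const)
    show "u + v \<in> V" if "u \<in> V" "v \<in> V" for u v
      using that convergent_add by (auto simp: V_def inner_add_right)
    show "c *\<^sub>R v \<in> V" if "v \<in> V" for c v
      using that convergent_mult[OF convergent_const, of "\<lambda>n. x (s n) \<bullet> v" c] by (simp add: V_def)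
  qed
  have "closed V"
  proof (rule closed_sequential_limits[THEN iffD2], intro allI impI, elim conjE)
    fix v w assume v: "\<forall>n. v n \<in> V" "v \<longlonglongrightarrow> w"
    have "Cauchy (\<lambda>n. x (s n) \<bullet> w)"
    proof (rule metric_CauchyI)
      fix e :: real assume e: "e > 0"
      \<comment> \<open>Replacing \<open>w\<close> by a nearby \<open>v j\<close> costs at most
        \<open>e / 3\<close> at each of the two indices. Using \<open>M + 1\<close> keeps the
        denominators positive even when \<open>M = 0\<close>.\<close>
      have "M \<ge> 0" using M[of 0] norm_ge_zero order_trans by blast
      have "\<exists>j. norm (v j - w) < e / (3 * (M + 1))"
        using LIMSEQ_D[OF v(2), of "e / (3 * (M + 1))"] e \<open>M \<ge> 0\<close> by auto
      then obtain j where j: "norm (v j - w) < e / (3 * (M + 1))" by blast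
      have close: "\<bar>x n \<bullet> v j - x n \<bullet> w\<bar> < e / 3" for n
      proof -
        have "\<bar>x n \<bullet> v j - x n \<bullet> w\<bar> \<le> norm (x n) * norm (v j - w)"
          using Cauchy_Schwarz_ineq2[of "x n" "v j - w"] by (simp add: inner_diff_right)
        also have "\<dots> \<le> (M + 1) * norm (v j - w)"
          using M[of n] by (intro mult_right_mono) auto
        also have "\<dots> < (M + 1) * (e / (3 * (M + 1)))"
          using \<open>M \<ge> 0\<close> j by (intro mult_strict_left_mono) auto
        also have "\<dots> = e / 3" using \<open>M \<ge> 0\<close> by (simp add: divide_simps)
        finally show ?thesis .
      qed
      have "Cauchy (\<lambda>n. x (s n) \<bullet> v j)"
        using v(1) convergent_Cauchy unfolding V_def by blast
      then obtain N where N: "\<forall>m\<ge>N. \<forall>n\<ge>N. dist (x (s m) \<bullet> v j) (x (s n) \<bullet> v j) < e / 3"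
        using metric_CauchyD[of "\<lambda>n. x (s n) \<bullet> v j" "e / 3"] e by auto
      show "\<exists>N. \<forall>m\<ge>N. \<forall>n\<ge>N. dist (x (s m) \<bullet> w) (x (s n) \<bullet> w) < e"
      proof (intro exI allI impI)
        fix m n assume "N \<le> m" "N \<le> n"
        then have "\<bar>x (s m) \<bullet> v j - x (s n) \<bullet> v j\<bar> < e / 3"
          using N by (simp add: dist_real_def)
        then show "dist (x (s m) \<bullet> w) (x (s n) \<bullet> w) < e"
          using close[of "s m"] close[of "s n"] unfolding dist_real_def by linarith
      qed
    qed
    then show "w \<in> V"
      by (simp add: V_def Cauchy_convergent_iff)
  qed
  define \<phi> where "\<phi> v = lim (\<lambda>n. x (s n) \<bullet> v)" for v
  have lim: "(\<lambda>n. x (s n) \<bullet> v) \<longlonglongrightarrow> \<phi> v" if "v \<in> V" for v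
    using that by (simp add: V_def \<phi>_def convergent_LIMSEQ_iff)
  obtain y where y: "y \<in> V" "\<And>v. v \<in> V \<Longrightarrow> \<phi> v = y \<bullet> v"
  proof (rule closed_subspace_Riesz[OF V \<open>closed V\<close>])
    fix u v assume "u \<in> V" "v \<in> V"
    then have "(\<lambda>n. x (s n) \<bullet> (u + v)) \<longlonglongrightarrow> \<phi> u + \<phi> v"
      unfolding inner_add_right by (intro tendsto_add lim)
    then show "\<phi> (u + v) = \<phi> u + \<phi> v"
      unfolding \<phi>_def[of "u + v"] by (rule limI)
  next
    fix c v assume "v \<in> V"
    then have "(\<lambda>n. x (s n) \<bullet> (c *\<^sub>R v)) \<longlonglongrightarrow> c * \<phi> v"
      unfolding inner_scaleR_right by (intro tendsto_mult tendsto_const lim)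
    then show "\<phi> (c *\<^sub>R v) = c * \<phi> v"
      unfolding \<phi>_def[of "c *\<^sub>R v"] by (rule limI)
  next
    fix v assume "v \<in> V"
    have "\<bar>x (s n) \<bullet> v\<bar> \<le> M * norm v" for n
      by (meson Cauchy_Schwarz_ineq2 M mult_right_mono norm_ge_zero order_trans)
    then show "\<bar>\<phi> v\<bar> \<le> M * norm v"
      by (intro LIMSEQ_le_const2[OF tendsto_rabs[OF lim[OF \<open>v \<in> V\<close>]]]) simp
  qed (rule that)
  have "(\<lambda>n. x (s n) \<bullet> v) \<longlonglongrightarrow> y \<bullet> v" for v
  proof -
    \<comment> \<open>\<open>w\<close> is the orthogonal projection of \<open>v\<close> onto
      \<open>V\<close>, obtained as the representative of the functional
      \<open>v \<bullet> u\<close> on \<open>V\<close>. As \<open>y\<close> and all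
      \<open>x (s n)\<close> lie in \<open>V\<close>, testing against \<open>v\<close> amounts to
      testing against \<open>w\<close>.\<close>
    obtain w where w: "w \<in> V" "\<And>u. u \<in> V \<Longrightarrow> v \<bullet> u = w \<bullet> u"
    proof (rule closed_subspace_Riesz[OF V \<open>closed V\<close>, of "\<lambda>u. v \<bullet> u" "norm v"])
      show "\<bar>v \<bullet> u\<bar> \<le> norm v * norm u" for u
        by (rule Cauchy_Schwarz_ineq2)
    qed (auto simp: inner_add_right intro: that)
    have "u \<bullet> v = u \<bullet> w" if "u \<in> V" for u
      using w(2)[OF that] by (simp add: inner_commute)
    then show ?thesis
      using lim[OF w(1)] y(2)[OF w(1)] y(1) xV by simp
  qed
  then have "weakly_converges (x \<circ> s) y"
    by (simp add: weakly_converges_def)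
  with s show ?thesis using that by blast
qed

section \<open>Fejer monotone sequences\<close>

definition fejer_monotone :: "'a::real_normed_vector set \<Rightarrow> (nat \<Rightarrow> 'a) \<Rightarrow> bool" where
  "fejer_monotone F x \<longleftrightarrow> (\<forall>z\<in>F. \<forall>k. norm (x (Suc k) - z) \<le> norm (x k - z))"

lemma fejer_monotone_le:
  assumes "fejer_monotone F x" "z \<in> F" "k \<le> n"
  shows "norm (x n - z) \<le> norm (x k - z)"
  using assms unfolding fejer_monotone_def
  by (auto intro: lift_Suc_antimono_le[of "\<lambda>n. norm (x n - z)", OF _ assms(3)])

lemma le_infdistI:
  assumes "A \<noteq> {}" "\<And>z. z \<in> A \<Longrightarrow> d \<le> dist x z"
  shows "d \<le> infdist x A"
  using assms by (simp add: infdist_notempty cINF_greatest)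

text \<open>Letting the index tend to infinity in the Fejer inequality shows that \<open>y\<close>
  is no farther from any \<open>z\<close> in \<open>F\<close> than \<open>x k\<close> is. The
  triangle inequality through \<open>z\<close> then costs the factor 2, which reappears in the
  linear rate.\<close>

lemma fejer_monotone_limit_le:
  assumes "fejer_monotone F x" "F \<noteq> {}" "x \<longlonglongrightarrow> y"
  shows "norm (x k - y) \<le> 2 * infdist (x k) F"
proof -
  have "norm (x k - y) / 2 \<le> infdist (x k) F"
  proof (rule le_infdistI[OF assms(2)])
    fix z assume z: "z \<in> F"
    have "norm (y - z) \<le> norm (x k - z)"
    proof (rule LIMSEQ_le_const2)
      show "(\<lambda>n. norm (x n - z)) \<longlonglongrightarrow> norm (y - z)"
        by (intro tendsto_intros assms)
      show "\<exists>N. \<forall>n\<ge>N. norm (x n - z) \<le> norm (x k - z)"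
        using fejer_monotone_le[OF assms(1) z] by blast
    qed
    then show "norm (x k - y) / 2 \<le> dist (x k) z"
      using norm_triangle_ineq4[of "x k - z" "y - z"] by (simp add: dist_norm)
  qed
  then show ?thesis by simp
qed

text \<open>Once some \<open>x N\<close> is within \<open>e / 2\<close> of a point of
  \<open>F\<close>, the whole tail stays in that ball, so the sequence is Cauchy. Continuity of the
  distance and closedness of \<open>F\<close> place the limit in \<open>F\<close>.\<close>

lemma fejer_monotone_convergent:
  fixes x :: "nat \<Rightarrow> 'a::{real_normed_vector, complete_space}"
  assumes fejer: "fejer_monotone F x" and F: "closed F" "F \<noteq> {}"
    and lim: "(\<lambda>k. infdist (x k) F) \<longlonglongrightarrow> 0"
  obtains y where "y \<in> F" "x \<longlonglongrightarrow> y"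
proof -
  have "Cauchy x"
  proof (rule metric_CauchyI)
    fix e :: real assume e: "e > 0"
    then have "\<forall>\<^sub>F k in sequentially. infdist (x k) F < e / 2"
      using order_tendstoD(2)[OF lim, of "e / 2"] by simp
    then obtain N where "infdist (x N) F < e / 2"
      by (auto simp: eventually_sequentially)
    then obtain z where z: "z \<in> F" "dist (x N) z < e / 2"
      unfolding infdist_notempty[OF F(2)] by (subst (asm) cINF_less_iff) (use F(2) in auto)
    have "dist (x n) z < e / 2" if "n \<ge> N" for n
      using fejer_monotone_le[OF fejer z(1) that] z(2) by (simp add: dist_norm)
    then have "dist (x m) (x n) < e" if "m \<ge> N" "n \<ge> N" for m n
      using dist_triangle_half_l[of "x m" z e "x n"] that by simp
    then show "\<exists>N. \<forall>m\<ge>N. \<forall>n\<ge>N. dist (x m) (x n) < e"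
      by blast
  qed
  then obtain y where y: "x \<longlonglongrightarrow> y"
    using Cauchy_convergent convergent_def by blast
  then have "infdist y F = 0"
    using LIMSEQ_unique[OF tendsto_infdist[OF y] lim] by simp
  then have "y \<in> F"
    using F by (simp add: in_closed_iff_infdist_zero)
  with y show ?thesis using that by blast
qed

text \<open>Opial's argument: if two weak cluster points \<open>y\<close>, \<open>w\<close> lie in \<open>F\<close>, then
  \<open>(norm (x k - y))\<^sup>2 - (norm (x k - w))\<^sup>2\<close> converges, hence so does \<open>x k \<bullet> (y - w)\<close>.\<close>

lemma fejer_monotone_weakly_convergent:
  fixes x :: "nat \<Rightarrow> 'a::{real_inner, complete_space}"
  assumes fejer: "fejer_monotone F x" and "F \<noteq> {}"
    and cluster: "\<And>s y. strict_mono s \<Longrightarrow> weakly_converges (x \<circ> s) y \<Longrightarrow> y \<in> F"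
  obtains y where "y \<in> F" "weakly_converges x y"
proof -
  obtain z where z: "z \<in> F" using \<open>F \<noteq> {}\<close> by blast
  have bdd: "norm (x n) \<le> norm (x 0 - z) + norm z" for n
    using fejer_monotone_le[OF fejer z, of 0 n] norm_triangle_ineq[of "x n - z" z] by simp
  obtain s y where s: "strict_mono s" "weakly_converges (x \<circ> s) y"
    using bounded_imp_weakly_convergent_subsequence[of x] bdd by blast
  have yF: "y \<in> F" using cluster s by blast
  have unique: "w = y" if t: "strict_mono t" "weakly_converges (x \<circ> t) w" for t w
  proof -
    have wF: "w \<in> F" using cluster t by blast
    have norm_conv: "\<exists>L. (\<lambda>n. norm (x n - u)) \<longlonglongrightarrow> L" if "u \<in> F" for u
    proof -
      have "decseq (\<lambda>n. norm (x n - u))"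
        unfolding decseq_def using fejer_monotone_le[OF fejer that] by blast
      moreover have "\<forall>n. 0 \<le> norm (x n - u)" by simp
      ultimately show ?thesis by (rule decseq_convergent) blast
    qed
    obtain L1 L2 where L: "(\<lambda>n. norm (x n - y)) \<longlonglongrightarrow> L1" "(\<lambda>n. norm (x n - w)) \<longlonglongrightarrow> L2"
      using norm_conv[OF yF] norm_conv[OF wF] by blast
    define c where "c = (L2\<^sup>2 - L1\<^sup>2 + (norm y)\<^sup>2 - (norm w)\<^sup>2) / 2"
    have "(\<lambda>n. ((norm (x n - w))\<^sup>2 - (norm (x n - y))\<^sup>2 + (norm y)\<^sup>2 - (norm w)\<^sup>2) / 2) \<longlonglongrightarrow> c"
      unfolding c_def by (intro tendsto_intros L) simp
    moreover have "((norm (u - w))\<^sup>2 - (norm (u - y))\<^sup>2 + (norm y)\<^sup>2 - (norm w)\<^sup>2) / 2 = u \<bullet> (y - w)" for u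
      by (simp add: power2_norm_eq_inner inner_diff inner_commute)
    ultimately have c: "(\<lambda>n. x n \<bullet> (y - w)) \<longlonglongrightarrow> c" by simp
    have "(\<lambda>n. x (s n) \<bullet> (y - w)) \<longlonglongrightarrow> c" "(\<lambda>n. x (t n) \<bullet> (y - w)) \<longlonglongrightarrow> c"
      using LIMSEQ_subseq_LIMSEQ[OF c s(1)] LIMSEQ_subseq_LIMSEQ[OF c t(1)] by (simp_all add: o_def)
    moreover have "(\<lambda>n. x (s n) \<bullet> (y - w)) \<longlonglongrightarrow> y \<bullet> (y - w)" "(\<lambda>n. x (t n) \<bullet> (y - w)) \<longlonglongrightarrow> w \<bullet> (y - w)"
      using s(2) t(2) by (simp_all add: weakly_converges_def)
    ultimately have "y \<bullet> (y - w) = c" "w \<bullet> (y - w) = c"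
      by (blast intro: LIMSEQ_unique)+
    then have "(y - w) \<bullet> (y - w) = 0" by (simp add: inner_diff_left)
    then show "w = y" by simp
  qed
  have "(\<lambda>n. x n \<bullet> v) \<longlonglongrightarrow> y \<bullet> v" for v
  \<comment> \<open>Otherwise some subsequence stays at least \<open>e\<close> away from
    \<open>y\<close> when tested against \<open>v\<close>. Being bounded, it has a weakly convergent
    subsequence, whose limit must be \<open>y\<close> by \<open>unique\<close>, a
    contradiction.\<close>
  proof (rule ccontr)
    assume "\<not> (\<lambda>n. x n \<bullet> v) \<longlonglongrightarrow> y \<bullet> v"
    then obtain e where e: "e > 0" "\<And>N. \<exists>n\<ge>N. \<bar>x n \<bullet> v - y \<bullet> v\<bar> \<ge> e"
      unfolding LIMSEQ_iff by (auto simp: not_less)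
    have "infinite {n. \<bar>x n \<bullet> v - y \<bullet> v\<bar> \<ge> e}"
      using e(2) by (auto simp: infinite_nat_iff_unbounded_le)
    then obtain t :: "nat \<Rightarrow> nat" where t: "strict_mono t" "\<And>n. \<bar>x (t n) \<bullet> v - y \<bullet> v\<bar> \<ge> e"
      using infinite_enumerate by blast
    obtain t' w where t': "strict_mono t'" "weakly_converges ((x \<circ> t) \<circ> t') w"
      using bounded_imp_weakly_convergent_subsequence[of "x \<circ> t"] bdd unfolding o_def by blast
    then have "w = y"
      using unique[of "t \<circ> t'"] t(1) by (simp add: strict_mono_o o_assoc)
    then have "(\<lambda>n. x (t (t' n)) \<bullet> v) \<longlonglongrightarrow> y \<bullet> v"
      using t'(2) by (simp add: weakly_converges_def)
    from LIMSEQ_D[OF this e(1)] obtain n where "\<bar>x (t (t' n)) \<bullet> v - y \<bullet> v\<bar> < e"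
      by auto
    then show False
      using t(2)[of "t' n"] by simp
  qed
  with yF show ?thesis using that by (auto simp: weakly_converges_def)
qed

section \<open>Relaxed cutters\<close>

text \<open>This is the cutter inequality rewritten with \<open>u = S x - x\<close>, where it reads
  \<open>u \<bullet> u \<le> (z - x) \<bullet> u\<close>, and rescaled by \<open>c\<close>. All
  later facts about relaxed cutters are drawn from it.\<close>

lemma relaxed_cutter_inner:
  assumes "relaxed_cutter c T" "c > 0" "z \<in> Fix T"
  shows "(norm (T x - x))\<^sup>2 / c \<le> (z - x) \<bullet> (T x - x)"
proof -
  obtain S where S: "cutter S" and T: "T = (\<lambda>x. x + c *\<^sub>R (S x - x))"
    using assms(1) unfolding relaxed_cutter_def by blast
  define u where "u = S x - x"
  have "z \<in> Fix S"
    using assms(2,3) by (simp add: T Fix_def)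
  then have "(z - S x) \<bullet> (x - S x) \<le> 0"
    using S unfolding cutter_def by blast
  moreover have "z - S x = (z - x) - u" "x - S x = - u"
    by (simp_all add: u_def)
  ultimately have "u \<bullet> u \<le> (z - x) \<bullet> u"
    by (simp add: inner_diff_left)
  moreover have "T x - x = c *\<^sub>R u"
    by (simp add: T u_def)
  ultimately show ?thesis
    using assms(2) by (simp add: power_mult_distrib power2_eq_square dot_square_norm)
qed

text \<open>\<open>T\<close> may be discontinuous, so the limit is taken in the fixed point instead:
  the cutter inequality based at the limit \<open>y\<close> survives as \<open>z n\<close> tends to
  \<open>y\<close> and leaves \<open>(norm (T y - y))\<^sup>2 / c \<le> 0\<close>.\<close>

lemma closed_Fix_relaxed_cutter:
  assumes "relaxed_cutter c T" "c > 0"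
  shows "closed (Fix T)"
  unfolding closed_sequential_limits
proof (intro allI impI, elim conjE)
  fix z y assume z: "\<forall>n. z n \<in> Fix T" "z \<longlonglongrightarrow> y"
  have "(\<lambda>n. (z n - y) \<bullet> (T y - y)) \<longlonglongrightarrow> (y - y) \<bullet> (T y - y)"
    by (intro tendsto_intros z)
  then have "(norm (T y - y))\<^sup>2 / c \<le> (y - y) \<bullet> (T y - y)"
    using relaxed_cutter_inner[OF assms] z(1) by (intro LIMSEQ_le_const) auto
  then show "y \<in> Fix T"
    using assms(2) by (simp add: Fix_def divide_le_0_iff)
qed

text \<open>Explains the radius \<open>R\<close>: \<open>T\<close> maps the ball of radius
  \<open>r\<close> around \<open>z\<close> into the one of radius \<open>R\<close>. For
  \<open>c \<le> 2\<close> distances to fixed points do not grow; for larger \<open>c\<close> they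
  grow at most by the factor \<open>c - 1\<close>.\<close>

lemma relaxed_cutter_norm_le:
  assumes T: "relaxed_cutter c T" "c > 0" "z \<in> Fix T" and r: "norm (x - z) \<le> r"
  shows "norm (T x - z) \<le> max r ((c - 1) * r)"
proof -
  define a where "a = T x - x"
  define d where "d = norm (x - z)"
  have a: "(norm a)\<^sup>2 / c \<le> (z - x) \<bullet> a"
    using relaxed_cutter_inner[OF T] by (simp add: a_def)
  also have "\<dots> \<le> d * norm a"
    using norm_cauchy_schwarz[of "z - x" a] by (simp add: d_def norm_minus_commute)
  finally have "norm a * norm a \<le> (c * d) * norm a"
    using \<open>c > 0\<close> by (simp add: power2_eq_square field_simps)
  then have na: "norm a \<le> c * d"
    using \<open>c > 0\<close> by (cases "a = 0") (auto simp: d_def)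
  have "T x - z = (x - z) + a" by (simp add: a_def)
  then have "(norm (T x - z))\<^sup>2 = d\<^sup>2 - 2 * ((z - x) \<bullet> a) + (norm a)\<^sup>2"
    by (simp add: d_def power2_norm_eq_inner inner_add inner_diff inner_commute)
  also have "\<dots> \<le> d\<^sup>2 + (1 - 2 / c) * (norm a)\<^sup>2"
    using a by (simp add: algebra_simps)
  finally have le: "(norm (T x - z))\<^sup>2 \<le> d\<^sup>2 + (1 - 2 / c) * (norm a)\<^sup>2" .
  show ?thesis
  proof (cases "c \<le> 2")
    case True
    then have "1 - 2 / c \<le> 0"
      using \<open>c > 0\<close> by (simp add: field_simps)
    then have "(norm (T x - z))\<^sup>2 \<le> d\<^sup>2"
      using le mult_nonpos_nonneg[of "1 - 2 / c" "(norm a)\<^sup>2"] by simp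
    then have "norm (T x - z) \<le> d"
      by (rule power2_le_imp_le) (simp add: d_def)
    then show ?thesis using r by (simp add: d_def)
  next
    case False
    \<comment> \<open>The coefficient is now positive, so the worst case is the largest displacement
      \<open>c * d\<close> allowed by Cauchy-Schwarz; there the bound is a perfect square.\<close>
    have "(1 - 2 / c) * (norm a)\<^sup>2 \<le> (1 - 2 / c) * (c * d)\<^sup>2"
      using na False by (intro mult_left_mono power_mono) auto
    also have "d\<^sup>2 + \<dots> = ((c - 1) * d)\<^sup>2"
      using False by (simp add: field_simps power2_eq_square)
    finally have "(norm (T x - z))\<^sup>2 \<le> ((c - 1) * d)\<^sup>2"
      using le by simp
    then have "norm (T x - z) \<le> (c - 1) * d"
      by (rule power2_le_imp_le) (use False in \<open>simp add: d_def\<close>)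
    also have "\<dots> \<le> (c - 1) * r"
      using r False by (intro mult_left_mono) (auto simp: d_def)
    finally show ?thesis by simp
  qed
qed

section \<open>Compositions of relaxed cutters\<close>

locale relaxed_cutter_pair =
  fixes T U :: "'a::real_inner \<Rightarrow> 'a" and l m \<nu> :: real
  assumes T: "relaxed_cutter l T" and l: "l > 0"
    and U: "relaxed_cutter m U" and m: "m > 0"
    and lm: "l * m < 4"
    and \<nu>: "\<nu> = 4 * (l + m - l * m) / (4 - l * m)"
begin

section \<open>Algebra of the relaxation constants\<close>

text \<open>In the theorem, \<open>p - q\<close> is \<alpha> and \<open>max p q\<close> is
  \<beta>.\<close>

definition p :: real where "p = sqrt (1 / l - 1 / \<nu>)"
definition q :: real where "q = sqrt (1 / m - 1 / \<nu>)"

text \<open>The sign for which the cross terms in \<open>composition_inner\<close> match. The case \<open>sgm = - 1\<close>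
  forces \<open>l \<noteq> m\<close>, so \<open>p + sgm * q\<close> never vanishes, even though \<open>p - q\<close> does when \<open>l = m\<close>.\<close>

definition sgm :: real where "sgm = (if 0 \<le> (2 - l) * (2 - m) then 1 else - 1)"

text \<open>Combines \<open>l * m < 4\<close> with the arithmetic-geometric mean inequality:
  \<open>(l * m)\<^sup>2 < 4 * (l * m) \<le> (l + m)\<^sup>2\<close>.\<close>

lemma D_pos: "0 < l + m - l * m"
proof -
  have "0 < l * m" using l m by simp
  have "(l * m)\<^sup>2 < 4 * (l * m)"
    using mult_strict_right_mono[OF lm \<open>0 < l * m\<close>] by (simp add: power2_eq_square)
  also have "\<dots> \<le> (l + m)\<^sup>2"
    using zero_le_power2[of "l - m"] by (simp add: power2_sum power2_diff)
  finally have "l * m < l + m"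
    using l m by (intro power_less_imp_less_base[of "l * m" 2]) auto
  then show ?thesis by simp
qed

lemma \<nu>_pos: "\<nu> > 0"
  using D_pos lm by (simp add: \<nu>)

text \<open>The square in the numerator makes the root in \<open>p\<close> well defined, shows that
  it vanishes only for \<open>l = 2\<close>, and allows \<open>p * q\<close> to be computed
  exactly.\<close>

lemma inverse_l_minus_inverse_\<nu>: "1 / l - 1 / \<nu> = m * (2 - l)\<^sup>2 / (4 * l * (l + m - l * m))"
proof -
  define D where "D = l + m - l * m"
  have D: "D > 0" using D_pos by (simp add: D_def)
  have "1 / l - 1 / \<nu> = 1 / l - (4 - l * m) / (4 * D)"
    by (simp add: \<nu> D_def)
  also have "\<dots> = (4 * D - l * (4 - l * m)) / (4 * l * D)"
    using l D by (simp add: field_simps)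
  also have "4 * D - l * (4 - l * m) = m * (2 - l)\<^sup>2"
    by (simp add: D_def power2_eq_square algebra_simps)
  finally show ?thesis by (simp add: D_def)
qed

lemma inverse_m_minus_inverse_\<nu>: "1 / m - 1 / \<nu> = l * (2 - m)\<^sup>2 / (4 * m * (l + m - l * m))"
proof -
  define D where "D = l + m - l * m"
  have D: "D > 0" using D_pos by (simp add: D_def)
  have "1 / m - 1 / \<nu> = 1 / m - (4 - l * m) / (4 * D)"
    by (simp add: \<nu> D_def)
  also have "\<dots> = (4 * D - m * (4 - l * m)) / (4 * m * D)"
    using m D by (simp add: field_simps)
  also have "4 * D - m * (4 - l * m) = l * (2 - m)\<^sup>2"
    by (simp add: D_def power2_eq_square algebra_simps)
  finally show ?thesis by (simp add: D_def)
qed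

lemma p_nonneg: "0 \<le> p" and q_nonneg: "0 \<le> q"
  and p_squared: "p\<^sup>2 = 1 / l - 1 / \<nu>" and q_squared: "q\<^sup>2 = 1 / m - 1 / \<nu>"
  using l m D_pos
  by (simp_all add: p_def q_def inverse_l_minus_inverse_\<nu> inverse_m_minus_inverse_\<nu>)

lemma p_eq_0_iff: "p = 0 \<longleftrightarrow> l = 2" and q_eq_0_iff: "q = 0 \<longleftrightarrow> m = 2"
  using l m D_pos
  by (auto simp: p_def q_def inverse_l_minus_inverse_\<nu> inverse_m_minus_inverse_\<nu>)

text \<open>Both roots vanish only for \<open>l = m = 2\<close>, which \<open>l * m < 4\<close>
  excludes.\<close>

lemma max_p_q_pos: "0 < max p q"
proof -
  have "p \<noteq> 0 \<or> q \<noteq> 0" using lm by (auto simp: p_eq_0_iff q_eq_0_iff)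
  then show ?thesis using p_nonneg q_nonneg by auto
qed

lemma p_eq_q_iff: "p = q \<longleftrightarrow> l = m"
  using l m by (auto simp: p_def q_def field_simps)

text \<open>The product of the roots is \<open>\<bar>(2 - l) * (2 - m)\<bar>\<close> over
  \<open>4 * D\<close>, and \<open>sgm\<close> restores the lost sign.\<close>

lemma sgm_p_q: "2 * sgm * p * q = 2 / \<nu> - 1"
proof -
  define D where "D = l + m - l * m"
  have D: "D > 0" using D_pos by (simp add: D_def)
  have prod: "m * u\<^sup>2 / (4 * l * D) * (l * w\<^sup>2 / (4 * m * D)) = (u * w / (4 * D))\<^sup>2" for u w
    using l m D by (simp add: field_simps power2_eq_square)
  have "p * q = sqrt (((2 - l) * (2 - m) / (4 * D))\<^sup>2)"
    unfolding p_def q_def real_sqrt_mult[symmetric]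
      inverse_l_minus_inverse_\<nu> inverse_m_minus_inverse_\<nu> D_def[symmetric] prod ..
  also have "\<dots> = \<bar>(2 - l) * (2 - m)\<bar> / (4 * D)"
    using D by (simp add: abs_divide abs_mult)
  finally have "2 * sgm * p * q = (2 - l) * (2 - m) / (2 * D)"
    by (auto simp: sgm_def abs_if mult.assoc)
  moreover have "2 / \<nu> - 1 = (2 - l) * (2 - m) / (2 * D)"
    using D lm by (simp add: \<nu> D_def[symmetric] divide_simps) (simp add: D_def algebra_simps)
  ultimately show ?thesis by simp
qed

lemma p_sgm_q_neq_0: "p + sgm * q \<noteq> 0"
proof (cases "0 \<le> (2 - l) * (2 - m)")
  case True
  then show ?thesis using p_nonneg q_nonneg max_p_q_pos by (simp add: sgm_def max_def split: if_splits)
next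
  case False
  then have "l \<noteq> m" by auto
  with False show ?thesis by (simp add: sgm_def p_eq_q_iff)
qed

text \<open>Passes from the natural constant \<open>\<bar>p + sgm * q\<bar>\<close> of the
  displacement bounds to the possibly smaller \<open>\<bar>\<alpha>\<bar>\<close> of the stated
  rate.\<close>

lemma abs_p_minus_q_le: "\<bar>p - q\<bar> \<le> \<bar>p + sgm * q\<bar>"
  using p_nonneg q_nonneg by (auto simp: sgm_def)

section \<open>Key inequality for the composition and displacement bounds\<close>

definition e :: "'a \<Rightarrow> 'a" where
  "e x = p *\<^sub>R (T x - x) - (sgm * q) *\<^sub>R (U (T x) - T x)"

text \<open>The inequality for \<open>U\<close> is based at \<open>T x\<close>; moving its base
  point to \<open>x\<close> produces the cross term \<open>a \<bullet> b\<close>. The coefficients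
  of the completed square match because \<open>1 / \<nu> + p\<^sup>2 = 1 / l\<close>,
  \<open>1 / \<nu> + q\<^sup>2 = 1 / m\<close>, and \<open>sgm_p_q\<close> makes the cross
  coefficient 1.\<close>

lemma composition_inner:
  assumes "z \<in> Fix T \<inter> Fix U"
  shows "(norm (U (T x) - x))\<^sup>2 / \<nu> + (norm (e x))\<^sup>2 \<le> (z - x) \<bullet> (U (T x) - x)"
proof -
  define a b where "a = T x - x" and "b = U (T x) - T x"
  have c: "U (T x) - x = a + b" and y: "z - T x = (z - x) - a"
    by (simp_all add: a_def b_def)
  have sgm2: "sgm\<^sup>2 = 1" by (simp add: sgm_def)
  have "(norm (a + b))\<^sup>2 / \<nu> + (norm (e x))\<^sup>2
      = (1 / \<nu> + p\<^sup>2) * (norm a)\<^sup>2 + (1 / \<nu> + q\<^sup>2) * (norm b)\<^sup>2 + (2 / \<nu> - 2 * sgm * p * q) * (a \<bullet> b)"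
  proof -
    have "(norm (e x))\<^sup>2 = p\<^sup>2 * (norm a)\<^sup>2 + (sgm\<^sup>2 * q\<^sup>2) * (norm b)\<^sup>2 - 2 * sgm * p * q * (a \<bullet> b)"
      unfolding e_def a_def[symmetric] b_def[symmetric] power2_norm_eq_inner
      by (simp add: inner_diff inner_commute power2_eq_square algebra_simps)
    moreover have "(norm (a + b))\<^sup>2 = (norm a)\<^sup>2 + 2 * (a \<bullet> b) + (norm b)\<^sup>2"
      unfolding power2_norm_eq_inner by (simp add: inner_add inner_commute)
    ultimately show ?thesis
      by (simp add: sgm2 algebra_simps add_divide_distrib)
  qed
  also have "\<dots> = (norm a)\<^sup>2 / l + (norm b)\<^sup>2 / m + a \<bullet> b"
    unfolding sgm_p_q p_squared q_squared by simp
  also have "\<dots> \<le> (z - x) \<bullet> a + (z - T x) \<bullet> b + a \<bullet> b"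
    using relaxed_cutter_inner[OF T l, of z x] relaxed_cutter_inner[OF U m, of z "T x"] assms
    by (simp add: a_def b_def)
  also have "\<dots> = (z - x) \<bullet> (a + b)"
    by (simp add: y inner_diff_left inner_add_right)
  finally show ?thesis by (simp add: c)
qed

text \<open>\<open>e x\<close> and \<open>U (T x) - x\<close> are two linear combinations of the
  displacements of \<open>T\<close> and \<open>U\<close>, with determinant
  \<open>p + sgm * q\<close> up to sign. Eliminating the displacement of \<open>U\<close> isolates
  that of \<open>T\<close>; the companion bound for \<open>U\<close> eliminates the other
  one.\<close>

lemma displacement_bound_T:
  "\<bar>p + sgm * q\<bar> * norm (T x - x) \<le> norm (e x) + max p q * norm (U (T x) - x)"
proof -
  have "(p + sgm * q) *\<^sub>R (T x - x) = e x + (sgm * q) *\<^sub>R (U (T x) - x)"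
    by (simp add: e_def algebra_simps)
  then have "\<bar>p + sgm * q\<bar> * norm (T x - x) = norm (e x + (sgm * q) *\<^sub>R (U (T x) - x))"
    by (metis norm_scaleR)
  also have "\<dots> \<le> norm (e x) + q * norm (U (T x) - x)"
    using norm_triangle_ineq[of "e x" "(sgm * q) *\<^sub>R (U (T x) - x)"] q_nonneg
    by (simp add: sgm_def split: if_splits)
  also have "q * norm (U (T x) - x) \<le> max p q * norm (U (T x) - x)"
    by (intro mult_right_mono) auto
  finally show ?thesis by simp
qed

lemma displacement_bound_U:
  "\<bar>p + sgm * q\<bar> * norm (U (T x) - T x) \<le> norm (e x) + max p q * norm (U (T x) - x)"
proof -
  have "(p + sgm * q) *\<^sub>R (U (T x) - T x) = p *\<^sub>R (U (T x) - x) - e x"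
    by (simp add: e_def algebra_simps)
  then have "\<bar>p + sgm * q\<bar> * norm (U (T x) - T x) = norm (p *\<^sub>R (U (T x) - x) - e x)"
    by (metis norm_scaleR)
  also have "\<dots> \<le> norm (e x) + p * norm (U (T x) - x)"
    using norm_triangle_ineq4[of "p *\<^sub>R (U (T x) - x)" "e x"] p_nonneg by simp
  also have "p * norm (U (T x) - x) \<le> max p q * norm (U (T x) - x)"
    by (intro mult_right_mono) auto
  finally show ?thesis by simp
qed

section \<open>Descent along the iteration\<close>

lemma relaxation_step:
  assumes z: "z \<in> Fix T \<inter> Fix U" and t: "\<epsilon> > 0" "t \<in> {\<epsilon>..2 - \<epsilon>}"
  shows "(norm (x + (t / \<nu>) *\<^sub>R (U (T x) - x) - z))\<^sup>2
    \<le> (norm (x - z))\<^sup>2 - (\<epsilon> / \<nu>)\<^sup>2 * (norm (U (T x) - x))\<^sup>2 - 2 * \<epsilon> / \<nu> * (norm (e x))\<^sup>2"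
proof -
  define c where "c = U (T x) - x"
  have sq: "(norm (w + s *\<^sub>R c))\<^sup>2 = (norm w)\<^sup>2 + 2 * s * (w \<bullet> c) + s\<^sup>2 * (norm c)\<^sup>2" for w and s :: real
    unfolding power2_norm_eq_inner
    by (simp add: inner_add inner_commute power2_eq_square algebra_simps)
  have minus: "(x - z) \<bullet> c = - ((z - x) \<bullet> c)"
    by (simp add: inner_diff_left)
  have shift: "x + (t / \<nu>) *\<^sub>R c - z = (x - z) + (t / \<nu>) *\<^sub>R c" by simp
  have "(norm (x + (t / \<nu>) *\<^sub>R c - z))\<^sup>2
      = (norm (x - z))\<^sup>2 - 2 * (t / \<nu>) * ((z - x) \<bullet> c) + (t / \<nu>)\<^sup>2 * (norm c)\<^sup>2"
    unfolding shift sq minus by simp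
  also have "\<dots> \<le> (norm (x - z))\<^sup>2 - 2 * (t / \<nu>) * ((norm c)\<^sup>2 / \<nu> + (norm (e x))\<^sup>2) + (t / \<nu>)\<^sup>2 * (norm c)\<^sup>2"
    using composition_inner[OF z, of x] t \<nu>_pos
    by (intro add_right_mono diff_left_mono mult_left_mono) (auto simp: c_def)
  also have "\<dots> = (norm (x - z))\<^sup>2 - t * (2 - t) / \<nu>\<^sup>2 * (norm c)\<^sup>2 - 2 * t / \<nu> * (norm (e x))\<^sup>2"
    using \<nu>_pos by (simp add: field_simps power2_eq_square)
  \<comment> \<open>Both \<open>t\<close> and \<open>2 - t\<close> are at least \<epsilon>, hence
    their product is at least \<open>\<epsilon> * \<epsilon>\<close>.\<close>
  also have "\<dots> \<le> (norm (x - z))\<^sup>2 - \<epsilon> * \<epsilon> / \<nu>\<^sup>2 * (norm c)\<^sup>2 - 2 * \<epsilon> / \<nu> * (norm (e x))\<^sup>2"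
    using t \<nu>_pos by (intro diff_mono order_refl mult_right_mono divide_right_mono mult_mono) auto
  finally show ?thesis
    by (simp add: c_def power2_eq_square)
qed

text \<open>The squared distances to \<open>z\<close> decrease to a limit, so consecutive
  differences vanish and dominate both loss terms. Hence \<open>U (T (x k)) - x k\<close> and
  \<open>e (x k)\<close> tend to 0, and the displacement bounds, divided by the nonzero
  \<open>\<bar>p + sgm * q\<bar>\<close>, carry this over to each operator.\<close>

lemma displacement_tendsto_0:
  assumes z: "z \<in> Fix T \<inter> Fix U" and "\<epsilon> > 0" "\<And>k. t k \<in> {\<epsilon>..2 - \<epsilon>}"
    and x: "\<And>k. x (Suc k) = x k + (t k / \<nu>) *\<^sub>R (U (T (x k)) - x k)"
  shows "(\<lambda>k. norm (T (x k) - x k)) \<longlonglongrightarrow> 0" "(\<lambda>k. norm (U (T (x k)) - T (x k))) \<longlonglongrightarrow> 0"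
proof -
  define d where "d k = (norm (x k - z))\<^sup>2" for k
  define A B where "A k = (\<epsilon> / \<nu>)\<^sup>2 * (norm (U (T (x k)) - x k))\<^sup>2"
    and "B k = 2 * \<epsilon> / \<nu> * (norm (e (x k)))\<^sup>2" for k
  have AB: "0 \<le> A k" "0 \<le> B k" for k
    using \<open>\<epsilon> > 0\<close> \<nu>_pos by (simp_all add: A_def B_def)
  have step: "d (Suc k) \<le> d k - A k - B k" for k
    using relaxation_step[OF z assms(2,3), of "x k"] by (simp add: d_def A_def B_def x)
  have "decseq d"
  proof (rule decseq_SucI)
    show "d (Suc k) \<le> d k" for k
      using step[of k] AB[of k] by simp
  qed
  moreover have "\<forall>k. 0 \<le> d k" by (simp add: d_def)
  ultimately obtain L where L: "d \<longlonglongrightarrow> L"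
    by (rule decseq_convergent)
  have diff: "(\<lambda>k. d k - d (Suc k)) \<longlonglongrightarrow> 0"
    using tendsto_diff[OF L LIMSEQ_Suc[OF L]] by simp
  have "A \<longlonglongrightarrow> 0" "B \<longlonglongrightarrow> 0"
    by (rule tendsto_sandwich[OF _ _ tendsto_const diff]; intro always_eventually allI;
        smt (verit) step AB)+
  then have "(\<lambda>k. sqrt (A k / (\<epsilon> / \<nu>)\<^sup>2)) \<longlonglongrightarrow> sqrt (0 / (\<epsilon> / \<nu>)\<^sup>2)"
    "(\<lambda>k. sqrt (B k / (2 * \<epsilon> / \<nu>))) \<longlonglongrightarrow> sqrt (0 / (2 * \<epsilon> / \<nu>))"
    using \<open>\<epsilon> > 0\<close> \<nu>_pos by (intro tendsto_real_sqrt tendsto_divide tendsto_const; simp)+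
  then have "(\<lambda>k. norm (U (T (x k)) - x k)) \<longlonglongrightarrow> 0" "(\<lambda>k. norm (e (x k))) \<longlonglongrightarrow> 0"
    using \<open>\<epsilon> > 0\<close> \<nu>_pos by (simp_all add: A_def B_def)
  then have "(\<lambda>k. (norm (e (x k)) + max p q * norm (U (T (x k)) - x k)) / \<bar>p + sgm * q\<bar>)
      \<longlonglongrightarrow> (0 + max p q * 0) / \<bar>p + sgm * q\<bar>"
    using p_sgm_q_neq_0 by (intro tendsto_intros) auto
  then have lim: "(\<lambda>k. (norm (e (x k)) + max p q * norm (U (T (x k)) - x k)) / \<bar>p + sgm * q\<bar>) \<longlonglongrightarrow> 0"
    by simp
  show "(\<lambda>k. norm (T (x k) - x k)) \<longlonglongrightarrow> 0"
    by (rule tendsto_sandwich[OF _ _ tendsto_const lim])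
      (use displacement_bound_T p_sgm_q_neq_0 in \<open>simp_all add: pos_le_divide_eq mult.commute[of _ "\<bar>_\<bar>"]\<close>)
  show "(\<lambda>k. norm (U (T (x k)) - T (x k))) \<longlonglongrightarrow> 0"
    by (rule tendsto_sandwich[OF _ _ tendsto_const lim])
      (use displacement_bound_U p_sgm_q_neq_0 in \<open>simp_all add: pos_le_divide_eq mult.commute[of _ "\<bar>_\<bar>"]\<close>)
qed

section \<open>Error bound under linear regularity\<close>

text \<open>Regularity bounds \<open>d\<close> by a multiple of \<open>M\<close>, while
  \<open>composition_inner\<close> bounds \<open>M\<close> only by \<open>N * sqrt (t * c)\<close>
  for a common fixed point at distance \<open>t\<close>. Squaring, taking the infimum over
  \<open>t\<close> and cancelling one factor \<open>d\<close> gives the claim; this is why the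
  constant is a square.\<close>

lemma linear_error_bound:
  assumes F: "Fix T \<inter> Fix U \<noteq> {}"
    and \<delta>: "\<delta>\<^sub>1 \<in> {0<..1}" "\<delta>\<^sub>2 \<in> {0<..1}" and "\<kappa> > 0"
    and reg_T: "\<delta>\<^sub>1 * infdist x (Fix T) \<le> norm (T x - x)"
    and reg_U: "\<delta>\<^sub>2 * infdist (T x) (Fix U) \<le> norm (U (T x) - T x)"
    and reg: "infdist x (Fix T \<inter> Fix U) \<le> \<kappa> * max (infdist x (Fix T)) (infdist x (Fix U))"
  shows "(\<bar>p - q\<bar> * min \<delta>\<^sub>1 \<delta>\<^sub>2 / (2 * \<kappa> * (1 + max p q * sqrt \<nu>)))\<^sup>2 * infdist x (Fix T \<inter> Fix U)
    \<le> norm (U (T x) - x)"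
proof -
  define d where "d = infdist x (Fix T \<inter> Fix U)"
  define c where "c = norm (U (T x) - x)"
  define \<eta> where "\<eta> = min \<delta>\<^sub>1 \<delta>\<^sub>2"
  define N where "N = 1 + max p q * sqrt \<nu>"
  define M where "M = norm (e x) + max p q * c"
  have \<eta>: "0 < \<eta>" "\<eta> \<le> \<delta>\<^sub>1" "\<eta> \<le> \<delta>\<^sub>2" "\<eta> \<le> 1"
    using \<delta> by (auto simp: \<eta>_def)
  have N: "N > 0"
    using max_p_q_pos \<nu>_pos by (simp add: N_def add_pos_nonneg)
  have d0: "0 \<le> d" and c0: "0 \<le> c"
    by (simp_all add: d_def c_def infdist_nonneg)
  have M0: "0 \<le> M"
    using max_p_q_pos c0 by (simp add: M_def)
  have "\<bar>p - q\<bar> * \<eta> * d \<le> 2 * \<kappa> * M"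
  proof -
    have "\<eta> * infdist x (Fix T) \<le> norm (T x - x)"
      using mult_right_mono[OF \<eta>(2) infdist_nonneg[of x "Fix T"]] reg_T by simp
    \<comment> \<open>Regularity of \<open>U\<close> is available at \<open>T x\<close>, so the
      distance is moved back to \<open>x\<close>; \<open>\<eta> \<le> 1\<close> absorbs the extra
      displacement of \<open>T\<close>.\<close>
    moreover have "\<eta> * infdist x (Fix U) \<le> norm (U (T x) - T x) + norm (T x - x)"
    proof -
      have "\<eta> * infdist x (Fix U) \<le> \<eta> * (infdist (T x) (Fix U) + norm (T x - x))"
        using infdist_triangle[of x "Fix U" "T x"] \<eta>(1)
        by (intro mult_left_mono) (auto simp: dist_norm norm_minus_commute)
      also have "\<dots> \<le> \<delta>\<^sub>2 * infdist (T x) (Fix U) + 1 * norm (T x - x)"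
        unfolding distrib_left using \<eta> by (intro add_mono mult_right_mono infdist_nonneg) auto
      finally show ?thesis using reg_U by simp
    qed
    ultimately have "\<eta> * max (infdist x (Fix T)) (infdist x (Fix U)) \<le> norm (T x - x) + norm (U (T x) - T x)"
      by (simp add: max_def add_increasing2)
    then have "\<bar>p - q\<bar> * (\<eta> * max (infdist x (Fix T)) (infdist x (Fix U)))
        \<le> \<bar>p + sgm * q\<bar> * (norm (T x - x) + norm (U (T x) - T x))"
      using \<eta>(1) by (intro mult_mono abs_p_minus_q_le) (auto simp: max_def infdist_nonneg)
    also have "\<dots> \<le> 2 * M"
      using displacement_bound_T[of x] displacement_bound_U[of x]
      by (simp add: M_def c_def distrib_left)
    finally have "\<kappa> * (\<bar>p - q\<bar> * (\<eta> * max (infdist x (Fix T)) (infdist x (Fix U)))) \<le> \<kappa> * (2 * M)"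
      using \<open>\<kappa> > 0\<close> by simp
    moreover have "\<bar>p - q\<bar> * \<eta> * d \<le> \<bar>p - q\<bar> * \<eta> * (\<kappa> * max (infdist x (Fix T)) (infdist x (Fix U)))"
      using reg \<eta>(1) unfolding d_def by (intro mult_left_mono) auto
    ultimately show ?thesis by (simp add: mult_ac)
  qed
  then have "\<bar>p - q\<bar> * \<eta> / (2 * \<kappa> * N) * d \<le> M / N"
    using \<open>\<kappa> > 0\<close> N by (simp add: field_simps)
  then have "(\<bar>p - q\<bar> * \<eta> / (2 * \<kappa> * N) * d)\<^sup>2 \<le> (M / N)\<^sup>2"
    using \<open>\<kappa> > 0\<close> N d0 \<eta>(1) by (intro power_mono) auto
  moreover define Q where "Q = (\<bar>p - q\<bar> * \<eta> / (2 * \<kappa> * N))\<^sup>2"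
  ultimately have Qd: "Q * d\<^sup>2 \<le> (M / N)\<^sup>2"
    by (simp only: power_mult_distrib)
  have *: "Q * d\<^sup>2 \<le> c * dist x w" if w: "w \<in> Fix T \<inter> Fix U" for w
  proof -
    define t where "t = dist x w"
    have "c\<^sup>2 / \<nu> + (norm (e x))\<^sup>2 \<le> t * c"
      using composition_inner[OF w, of x] norm_cauchy_schwarz[of "w - x" "U (T x) - x"]
      by (simp add: c_def t_def dist_norm norm_minus_commute)
    moreover have "0 \<le> c\<^sup>2 / \<nu>" using \<nu>_pos by simp
    ultimately have e: "(norm (e x))\<^sup>2 \<le> t * c" and c: "c\<^sup>2 / \<nu> \<le> t * c"
      by (auto intro: order_trans[rotated] simp: add_increasing add_increasing2)
    have "norm (e x) \<le> sqrt (t * c)"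
      using e by (rule real_le_rsqrt)
    moreover have "c \<le> sqrt \<nu> * sqrt (t * c)"
      using c \<nu>_pos by (simp add: real_sqrt_mult[symmetric] field_simps real_le_rsqrt)
    ultimately have "M \<le> sqrt (t * c) + max p q * (sqrt \<nu> * sqrt (t * c))"
      unfolding M_def using max_p_q_pos by (intro add_mono mult_left_mono) auto
    then have "M / N \<le> sqrt (t * c)"
      using N by (simp add: N_def field_simps)
    then have "(M / N)\<^sup>2 \<le> (sqrt (t * c))\<^sup>2"
      using M0 N by (intro power_mono) auto
    also have "\<dots> = c * t" using c0 by (simp add: t_def)
    finally show ?thesis using Qd by (simp add: t_def)
  qed
  \<comment> \<open>The infimum over \<open>w\<close> is taken after dividing by \<open>c\<close>.
    If \<open>c = 0\<close>, a single common fixed point already gives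
    \<open>Q * d\<^sup>2 \<le> 0\<close>.\<close>
  have "Q * d\<^sup>2 \<le> c * d"
  proof (cases "c = 0")
    case True
    then show ?thesis using * F by auto
  next
    case False
    then have "c > 0" using c0 by simp
    then have "Q * d\<^sup>2 / c \<le> d"
      unfolding d_def infdist_notempty[OF F] using * F
      by (intro cINF_greatest) (auto simp: d_def[unfolded infdist_notempty[OF F], symmetric] field_simps)
    then show ?thesis using \<open>c > 0\<close> by (simp add: field_simps)
  qed
  then have "Q * d \<le> c"
    using d0 c0 by (cases "d = 0") (auto simp: power2_eq_square)
  then show ?thesis
    by (simp add: Q_def d_def c_def \<eta>_def N_def)
qed

end

section \<open>The convergence theorem\<close>

lemma linearly_regular_imp_regular:
  assumes "linearly_regular_over \<delta> T S" "\<delta> > 0"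
  shows "regular_over T S"
  unfolding regular_over_def
proof (intro allI impI)
  fix x assume x: "\<forall>k. x k \<in> S" "(\<lambda>k. norm (T (x k) - x k)) \<longlonglongrightarrow> 0"
  from tendsto_divide_zero[OF x(2)]
  have lim: "(\<lambda>k. norm (T (x k) - x k) / \<delta>) \<longlonglongrightarrow> 0" .
  show "(\<lambda>k. infdist (x k) (Fix T)) \<longlonglongrightarrow> 0"
    by (rule tendsto_sandwich[OF _ _ tendsto_const lim])
      (use assms x(1) in \<open>simp_all add: linearly_regular_over_def infdist_nonneg pos_le_divide_eq mult.commute\<close>)
qed

lemma pair_linearly_regular_imp_regular:
  assumes "pair_linearly_regular_over \<kappa> A B S"
  shows "pair_regular_over A B S"
  unfolding pair_regular_over_def
proof (intro allI impI)
  fix x assume x: "\<forall>k. x k \<in> S" "(\<lambda>k. max (infdist (x k) A) (infdist (x k) B)) \<longlonglongrightarrow> 0"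
  from tendsto_mult_right_zero[OF x(2)]
  have lim: "(\<lambda>k. \<kappa> * max (infdist (x k) A) (infdist (x k) B)) \<longlonglongrightarrow> 0" .
  show "(\<lambda>k. infdist (x k) (A \<inter> B)) \<longlonglongrightarrow> 0"
    by (rule tendsto_sandwich[OF _ _ tendsto_const lim])
      (use assms x(1) in \<open>simp_all add: pair_linearly_regular_over_def infdist_nonneg\<close>)
qed

text \<open>For \<open>l = m\<close> the two roots coincide, so \<alpha> and \<delta> vanish and the
  factor in the linear statement is 1. Accordingly \<open>\<alpha> \<noteq> 0\<close> is asserted
  for \<open>l \<noteq> m\<close>, whereas \<beta> is positive in every case.\<close>

theorem theorem4p1:
  fixes T U :: "'a::{real_inner, complete_space} \<Rightarrow> 'a"
    and l m \<epsilon> \<nu> r R \<alpha> \<beta> :: real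
    and a :: "nat \<Rightarrow> real"
    and x :: "nat \<Rightarrow> 'a"
    and z :: 'a
  assumes "l > 0" and "m > 0"
    and "relaxed_cutter l T" and "relaxed_cutter m U"
    and "l * m < 4"
    and "Fix T \<inter> Fix U \<noteq> {}"
    and "\<nu> = 4 * (l + m - l * m) / (4 - l * m)"
    and "\<epsilon> > 0"
    and "\<And>k. a k \<in> {\<epsilon>..2 - \<epsilon>}"
    and "\<And>k. x (Suc k) = x k + (a k / \<nu>) *\<^sub>R (U (T (x k)) - x k)"
    and "z \<in> Fix T \<inter> Fix U"
    and "r = norm (x 0 - z)" and "r > 0"
    and "R = max r ((l - 1) * r)"
    and "\<alpha> = sqrt (1 / l - 1 / \<nu>) - sqrt (1 / m - 1 / \<nu>)"
    and "\<beta> = max (sqrt (1 / l - 1 / \<nu>)) (sqrt (1 / m - 1 / \<nu>))"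
  shows
    "(weakly_regular_over T (cball z r) \<and> weakly_regular_over U (cball z R)
        \<longrightarrow> (\<exists>y\<in>Fix T \<inter> Fix U. weakly_converges x y))
   \<and> (regular_over T (cball z r) \<and> regular_over U (cball z R)
        \<and> pair_regular_over (Fix T) (Fix U) (cball z r)
        \<longrightarrow> (\<exists>y\<in>Fix T \<inter> Fix U. x \<longlonglongrightarrow> y))
   \<and> (\<forall>\<delta>\<^sub>1 \<delta>\<^sub>2 \<kappa>. \<delta>\<^sub>1 \<in> {0<..1} \<and> \<delta>\<^sub>2 \<in> {0<..1} \<and> \<kappa> > 0
        \<and> linearly_regular_over \<delta>\<^sub>1 T (cball z r) \<and> linearly_regular_over \<delta>\<^sub>2 U (cball z R)
        \<and> pair_linearly_regular_over \<kappa> (Fix T) (Fix U) (cball z r)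
        \<longrightarrow> (let \<delta> = (\<bar>\<alpha>\<bar> * min \<delta>\<^sub>1 \<delta>\<^sub>2 / (2 * \<kappa> * (1 + \<beta> * sqrt \<nu>)))\<^sup>2
             in \<exists>y\<in>Fix T \<inter> Fix U. x \<longlonglongrightarrow> y \<and>
                  (\<forall>k. norm (x (Suc k) - y) \<le> sqrt (1 - (\<epsilon> * \<delta> / (2 * \<nu>))\<^sup>2) * norm (x k - y))))
   \<and> (l \<noteq> m \<longrightarrow> \<alpha> \<noteq> 0) \<and> \<beta> > 0"
proof -
  define F where "F = Fix T \<inter> Fix U"
  interpret relaxed_cutter_pair T U l m \<nu>
    using assms by unfold_locales
  have \<alpha>: "\<alpha> = p - q" and \<beta>: "\<beta> = max p q"
    using assms(15,16) by (simp_all add: p_def q_def)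
  note a = assms(9) and x_Suc = assms(10)
  have zF: "z \<in> F" and zT: "z \<in> Fix T" and F: "F \<noteq> {}"
    using assms(11) by (auto simp: F_def)
  have "closed F"
    unfolding F_def using closed_Fix_relaxed_cutter[OF T l] closed_Fix_relaxed_cutter[OF U m]
    by (rule closed_Int)
  \<comment> \<open>The loss term with \<open>e\<close> is dropped: Fejer monotonicity and the
    contraction estimate use only the loss in \<open>U (T (x k)) - x k\<close>.\<close>
  have step: "(norm (x (Suc k) - w))\<^sup>2
      \<le> (norm (x k - w))\<^sup>2 - (\<epsilon> / \<nu>)\<^sup>2 * (norm (U (T (x k)) - x k))\<^sup>2" if "w \<in> F" for w k
  proof -
    have "0 \<le> 2 * \<epsilon> / \<nu> * (norm (e (x k)))\<^sup>2"
      using \<open>\<epsilon> > 0\<close> \<nu>_pos by simp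
    then show ?thesis
      using relaxation_step[OF that[unfolded F_def] \<open>\<epsilon> > 0\<close> a, of "x k" k] unfolding x_Suc by linarith
  qed
  have fejer: "fejer_monotone F x"
    unfolding fejer_monotone_def
  proof (intro ballI allI)
    fix w k assume "w \<in> F"
    have "(norm (x (Suc k) - w))\<^sup>2 \<le> (norm (x k - w))\<^sup>2"
      by (rule order_trans[OF step[OF \<open>w \<in> F\<close>]]) simp
    then show "norm (x (Suc k) - w) \<le> norm (x k - w)"
      by (rule power2_le_imp_le) simp
  qed
  have x_r: "norm (x k - z) \<le> r" for k
    using fejer_monotone_le[OF fejer zF, of 0 k] assms(12) by simp
  then have x_ball: "x k \<in> cball z r" for k
    by (simp add: dist_norm norm_minus_commute)
  \<comment> \<open>The radius \<open>R\<close> enters here: \<open>U\<close> is evaluated at the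
    points \<open>T (x k)\<close>, which may leave the ball of radius \<open>r\<close>.\<close>
  have Tx_ball: "T (x k) \<in> cball z R" for k
    using relaxed_cutter_norm_le[OF T l zT x_r] assms(14) by (simp add: dist_norm norm_minus_commute)
  note Tx = displacement_tendsto_0(1)[where x = x and t = a, OF zF[unfolded F_def] \<open>\<epsilon> > 0\<close> a x_Suc]
  note UTx = displacement_tendsto_0(2)[where x = x and t = a, OF zF[unfolded F_def] \<open>\<epsilon> > 0\<close> a x_Suc]
  have weak: "\<exists>y\<in>F. weakly_converges x y"
    if reg: "weakly_regular_over T (cball z r)" "weakly_regular_over U (cball z R)"
  proof -
    have "y \<in> F" if s: "strict_mono s" "weakly_converges (x \<circ> s) y" for s y
    proof -
      have Ts: "(\<lambda>k. norm (T ((x \<circ> s) k) - (x \<circ> s) k)) \<longlonglongrightarrow> 0"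
        and Us: "(\<lambda>k. norm (U ((T \<circ> x \<circ> s) k) - (T \<circ> x \<circ> s) k)) \<longlonglongrightarrow> 0"
        using LIMSEQ_subseq_LIMSEQ[OF Tx s(1)] LIMSEQ_subseq_LIMSEQ[OF UTx s(1)]
        by (simp_all add: o_def)
      \<comment> \<open>The displacements of \<open>T\<close> vanish in norm, so the shifted
        sequence has the same weak limit and regularity of \<open>U\<close> applies to it.\<close>
      have "weakly_converges (T \<circ> x \<circ> s) y"
        unfolding weakly_converges_def
      proof
        fix v
        have diff: "(\<lambda>k. T (x (s k)) - x (s k)) \<longlonglongrightarrow> 0"
          using Ts by (simp add: tendsto_norm_zero_iff)
        have "(\<lambda>k. x (s k) \<bullet> v) \<longlonglongrightarrow> y \<bullet> v"
          using s(2) by (simp add: weakly_converges_def)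
        then have "(\<lambda>k. x (s k) \<bullet> v + (T (x (s k)) - x (s k)) \<bullet> v) \<longlonglongrightarrow> y \<bullet> v + 0 \<bullet> v"
          by (rule tendsto_add[OF _ tendsto_inner[OF diff tendsto_const]])
        then show "(\<lambda>k. (T \<circ> x \<circ> s) k \<bullet> v) \<longlonglongrightarrow> y \<bullet> v"
          by (simp add: inner_diff_left)
      qed
      then have "y \<in> Fix U"
        using reg(2) Us Tx_ball unfolding weakly_regular_over_def by (metis comp_apply)
      moreover have "y \<in> Fix T"
        using reg(1) Ts s(2) x_ball unfolding weakly_regular_over_def by (metis comp_apply)
      ultimately show ?thesis by (simp add: F_def)
    qed
    then show ?thesis
      using fejer_monotone_weakly_convergent[OF fejer F] by blast
  qed
  have strong: "\<exists>y\<in>F. x \<longlonglongrightarrow> y"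
    if reg: "regular_over T (cball z r)" "regular_over U (cball z R)"
      "pair_regular_over (Fix T) (Fix U) (cball z r)"
  proof -
    have dT: "(\<lambda>k. infdist (x k) (Fix T)) \<longlonglongrightarrow> 0"
      using reg(1) x_ball Tx unfolding regular_over_def by blast
    have "(\<lambda>k. infdist (T (x k)) (Fix U)) \<longlonglongrightarrow> 0"
      using reg(2)[unfolded regular_over_def, rule_format, of "\<lambda>k. T (x k)"] Tx_ball UTx by blast
    then have lim: "(\<lambda>k. infdist (T (x k)) (Fix U) + norm (T (x k) - x k)) \<longlonglongrightarrow> 0"
      using tendsto_add[OF _ Tx] by fastforce
    \<comment> \<open>Regularity of \<open>U\<close> controls the distance from
      \<open>T (x k)\<close>; adding the vanishing displacement of \<open>T\<close> controls it from
      \<open>x k\<close>.\<close>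
    have dU: "(\<lambda>k. infdist (x k) (Fix U)) \<longlonglongrightarrow> 0"
    proof (rule tendsto_sandwich[OF _ _ tendsto_const lim])
      show "\<forall>\<^sub>F k in sequentially. infdist (x k) (Fix U) \<le> infdist (T (x k)) (Fix U) + norm (T (x k) - x k)"
      proof (intro always_eventually allI)
        show "infdist (x k) (Fix U) \<le> infdist (T (x k)) (Fix U) + norm (T (x k) - x k)" for k
          using infdist_triangle[of "x k" "Fix U" "T (x k)"] by (simp add: dist_norm norm_minus_commute)
      qed
    qed (simp add: infdist_nonneg)
    have "(\<lambda>k. max (infdist (x k) (Fix T)) (infdist (x k) (Fix U))) \<longlonglongrightarrow> 0"
      using tendsto_max[OF dT dU] by simp
    then have "(\<lambda>k. infdist (x k) F) \<longlonglongrightarrow> 0"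
      using reg(3) x_ball unfolding pair_regular_over_def F_def by blast
    then show ?thesis
      using fejer_monotone_convergent[OF fejer \<open>closed F\<close> F] by blast
  qed
  have linear: "\<exists>y\<in>F. x \<longlonglongrightarrow> y \<and>
      (\<forall>k. norm (x (Suc k) - y) \<le> sqrt (1 - (\<epsilon> * \<delta> / (2 * \<nu>))\<^sup>2) * norm (x k - y))"
    if \<delta>12: "\<delta>\<^sub>1 \<in> {0<..1}" "\<delta>\<^sub>2 \<in> {0<..1}" and "\<kappa> > 0"
      and reg: "linearly_regular_over \<delta>\<^sub>1 T (cball z r)" "linearly_regular_over \<delta>\<^sub>2 U (cball z R)"
        "pair_linearly_regular_over \<kappa> (Fix T) (Fix U) (cball z r)"
      and \<delta>: "\<delta> = (\<bar>\<alpha>\<bar> * min \<delta>\<^sub>1 \<delta>\<^sub>2 / (2 * \<kappa> * (1 + \<beta> * sqrt \<nu>)))\<^sup>2"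
    for \<delta>\<^sub>1 \<delta>\<^sub>2 \<kappa> \<delta>
  proof -
    \<comment> \<open>Linear regularity implies regularity, so the limit comes from the norm
      convergence statement; only the rate remains.\<close>
    obtain y where y: "y \<in> F" "x \<longlonglongrightarrow> y"
      using strong linearly_regular_imp_regular[OF reg(1)] linearly_regular_imp_regular[OF reg(2)]
        pair_linearly_regular_imp_regular[OF reg(3)] \<delta>12 by auto
    have "norm (x (Suc k) - y) \<le> sqrt (1 - (\<epsilon> * \<delta> / (2 * \<nu>))\<^sup>2) * norm (x k - y)" for k
    proof -
      define c where "c = norm (U (T (x k)) - x k)"
      have "\<delta> * infdist (x k) F \<le> c"
        unfolding \<delta> \<alpha> \<beta> F_def c_def
        using reg x_ball Tx_ball assms(6) \<delta>12 \<open>\<kappa> > 0\<close>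
        by (intro linear_error_bound)
          (auto simp: linearly_regular_over_def pair_linearly_regular_over_def)
      moreover have "norm (x k - y) \<le> 2 * infdist (x k) F"
        using fejer F y(2) by (rule fejer_monotone_limit_le)
      then have "\<delta> * norm (x k - y) \<le> \<delta> * (2 * infdist (x k) F)"
        by (intro mult_left_mono) (simp_all add: \<delta>)
      \<comment> \<open>The error bound is in terms of the distance to \<open>F\<close>; the Fejer
        estimate replaces it by the distance to the limit, which yields the 2 in
        \<open>2 * \<nu>\<close>.\<close>
      ultimately have "\<delta> * norm (x k - y) / 2 \<le> c" by simp
      then have "\<epsilon> / \<nu> * (\<delta> * norm (x k - y) / 2) \<le> \<epsilon> / \<nu> * c"
        using \<open>\<epsilon> > 0\<close> \<nu>_pos by (intro mult_left_mono) auto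
      then have "(\<epsilon> / \<nu> * (\<delta> * norm (x k - y) / 2))\<^sup>2 \<le> (\<epsilon> / \<nu> * c)\<^sup>2"
        using \<open>\<epsilon> > 0\<close> \<nu>_pos by (intro power_mono) (auto simp: \<delta>)
      then have "(\<epsilon> * \<delta> / (2 * \<nu>))\<^sup>2 * (norm (x k - y))\<^sup>2 \<le> (\<epsilon> / \<nu>)\<^sup>2 * c\<^sup>2"
        by (simp add: power_mult_distrib power_divide mult_ac)
      then have "(norm (x (Suc k) - y))\<^sup>2 \<le> (1 - (\<epsilon> * \<delta> / (2 * \<nu>))\<^sup>2) * (norm (x k - y))\<^sup>2"
        using step[OF y(1), of k] by (simp add: c_def left_diff_distrib)
      \<comment> \<open>Real \<open>sqrt\<close> is monotone and multiplicative on all reals,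
        negative arguments included, so the sign of the contraction factor needs no separate
        case.\<close>
      then have "sqrt ((norm (x (Suc k) - y))\<^sup>2) \<le> sqrt ((1 - (\<epsilon> * \<delta> / (2 * \<nu>))\<^sup>2) * (norm (x k - y))\<^sup>2)"
        by (rule real_sqrt_le_mono)
      then show ?thesis by (simp add: real_sqrt_mult)
    qed
    with y show ?thesis by blast
  qed
  show ?thesis
    unfolding Let_def F_def[symmetric]
    using weak strong linear[OF _ _ _ _ _ _ refl] p_eq_q_iff max_p_q_pos
    by (intro conjI allI impI) (auto simp: \<alpha> \<beta>)
qed

end
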